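(* Let $a>0$ and let $S=\mathbb{R}^4$ with coordinates $(x_0,x_1,x_2,x_3)$ be equipped with the Gödel Lorentz metric $$ds^2=a^2\left(dx_0^2+2e^{x_1}dx_0\,dx_2+\frac{e^{2x_1}}{2}dx_2^2-dx_1^2-dx_3^2\right).$$ Then $(S,ds^2)$ (the Gödel Universe) has neither isotropic nor timelike closed geodesics.
   Context: The metric $ds^2$ has signature $(+,-,-,-)$. A geodesic $\gamma:\mathbb{R}\to S$ (affinely parametrized, non-constant) is timelike if $ds^2(\gamma',\gamma')>0$ and isotropic (null, lightlike) if $ds^2(\gamma',\gamma')=0$ with $\gamma'\neq 0$. A geodesic $\gamma$ is closed if it is periodic, i.e. there is $T>0$ with $\gamma(t+T)=\gamma(t)$ for all $t\in\mathbb{R}$. *)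

theory Defs
  imports "HOL-Analysis.Analysis"
begin

text \<open>
  A pseudo-Riemannian metric on the coordinate space \<open>real ^ 'n\<close> is given by its matrix-valued
  coefficient function: \<open>g p $ i $ j\<close> is the coefficient \<open>g\<^sub>i\<^sub>j\<close> at the point \<open>p\<close>. Tangent vectors at
  any point are identified with elements of \<open>real ^ 'n\<close>.
\<close>

type_synonym 'n metric_tensor = "real ^ 'n \<Rightarrow> real ^ 'n ^ 'n"

definition metric_form :: "'n::finite metric_tensor \<Rightarrow> real ^ 'n \<Rightarrow> real ^ 'n \<Rightarrow> real ^ 'n \<Rightarrow> real" where
  "metric_form g p v w = (\<Sum>i\<in>UNIV. \<Sum>j\<in>UNIV. g p $ i $ j * v $ i * w $ j)"

definition partial :: "'n::finite \<Rightarrow> (real ^ 'n \<Rightarrow> real) \<Rightarrow> real ^ 'n \<Rightarrow> real" where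
  "partial i f p = deriv (\<lambda>t. f (p + t *\<^sub>R axis i 1)) 0"

text \<open>Christoffel symbols of the Levi-Civita connection; \<open>k\<close> is the upper index.\<close>

definition christoffel :: "'n::finite metric_tensor \<Rightarrow> 'n \<Rightarrow> 'n \<Rightarrow> 'n \<Rightarrow> real ^ 'n \<Rightarrow> real" where
  "christoffel g k i j p = (1 / 2) * (\<Sum>l\<in>UNIV. matrix_inv (g p) $ k $ l *
     (partial i (\<lambda>q. g q $ j $ l) p + partial j (\<lambda>q. g q $ i $ l) p - partial l (\<lambda>q. g q $ i $ j) p))"

definition velocity :: "(real \<Rightarrow> real ^ 'n::finite) \<Rightarrow> real \<Rightarrow> real ^ 'n" where
  "velocity \<gamma> t = vector_derivative \<gamma> (at t)"

text \<open>
  Geodesics are complete (defined on all of \<open>\<real>\<close>), affinely parametrized and non-constant. Asking for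
  two derivatives is enough: for a smooth metric the equation makes every solution smooth.
\<close>

definition geodesic :: "'n::finite metric_tensor \<Rightarrow> (real \<Rightarrow> real ^ 'n) \<Rightarrow> bool" where
  "geodesic g \<gamma> \<longleftrightarrow>
     (\<forall>t. \<gamma> differentiable at t) \<and>
     (\<forall>t. velocity \<gamma> differentiable at t) \<and>
     (\<forall>t k. velocity (velocity \<gamma>) t $ k +
        (\<Sum>i\<in>UNIV. \<Sum>j\<in>UNIV. christoffel g k i j (\<gamma> t) * velocity \<gamma> t $ i * velocity \<gamma> t $ j) = 0) \<and>
     \<not> \<gamma> constant_on UNIV"

text \<open>The sign convention is that of signature \<open>(+,-,-,-)\<close>.\<close>

definition timelike :: "'n::finite metric_tensor \<Rightarrow> (real \<Rightarrow> real ^ 'n) \<Rightarrow> bool" where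
  "timelike g \<gamma> \<longleftrightarrow> (\<forall>t. metric_form g (\<gamma> t) (velocity \<gamma> t) (velocity \<gamma> t) > 0)"

definition isotropic :: "'n::finite metric_tensor \<Rightarrow> (real \<Rightarrow> real ^ 'n) \<Rightarrow> bool" where
  "isotropic g \<gamma> \<longleftrightarrow>
     (\<forall>t. metric_form g (\<gamma> t) (velocity \<gamma> t) (velocity \<gamma> t) = 0 \<and> velocity \<gamma> t \<noteq> 0)"

definition closed_curve :: "(real \<Rightarrow> real ^ 'n::finite) \<Rightarrow> bool" where
  "closed_curve \<gamma> \<longleftrightarrow> (\<exists>T>0. \<forall>t. \<gamma> (t + T) = \<gamma> t)"

text \<open>The four elements of the index type \<open>4\<close> are \<open>0, 1, 2, 3\<close>, with \<open>4 = 0\<close>.\<close>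

definition godel_metric :: "real \<Rightarrow> 4 metric_tensor" where
  "godel_metric a p = (\<chi> i j. a\<^sup>2 *
     (if i = 0 \<and> j = 0 then 1
      else if i = 0 \<and> j = 2 \<or> i = 2 \<and> j = 0 then exp (p $ 1)
      else if i = 2 \<and> j = 2 then exp (2 * p $ 1) / 2
      else if i = 1 \<and> j = 1 \<or> i = 3 \<and> j = 3 then - 1
      else 0))"

lemma UNIV_4': "(UNIV :: 4 set) = {0, 1, 2, 3}"
proof -
  have "(4 :: 4) = 0" by simp
  then have "(UNIV :: 4 set) = {1, 2, 3, 0}"
    using UNIV_4 by metis
  then show ?thesis by blast
qed

lemma godel_line_element:
  "metric_form (godel_metric a) p v v =
     a\<^sup>2 * ((v $ 0)\<^sup>2 + 2 * exp (p $ 1) * v $ 0 * v $ 2 + exp (2 * p $ 1) / 2 * (v $ 2)\<^sup>2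
          - (v $ 1)\<^sup>2 - (v $ 3)\<^sup>2)"
  unfolding metric_form_def godel_metric_def UNIV_4' by (simp, algebra)

text \<open>Nondegeneracy, so that \<open>matrix_inv\<close> in the Christoffel symbols is the actual inverse.\<close>

lemma invertible_godel_metric:
  assumes "a > 0"
  shows "invertible (godel_metric a p)"
proof -
  define E where "E = exp (p $ 1)"
  have E: "E \<noteq> 0" and E2: "exp (2 * p $ 1) = E * E"
    by (simp_all add: E_def flip: exp_add)
  define A :: "4 \<Rightarrow> 4 \<Rightarrow> real" where "A i j =
     (if i = 0 \<and> j = 0 then 1
      else if i = 0 \<and> j = 2 \<or> i = 2 \<and> j = 0 then E
      else if i = 2 \<and> j = 2 then E * E / 2
      else if i = 1 \<and> j = 1 \<or> i = 3 \<and> j = 3 then - 1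
      else 0)" for i j
  define B :: "4 \<Rightarrow> 4 \<Rightarrow> real" where "B i j =
     (if i = 0 \<and> j = 0 then - 1
      else if i = 0 \<and> j = 2 \<or> i = 2 \<and> j = 0 then 2 / E
      else if i = 2 \<and> j = 2 then - 2 / (E * E)
      else if i = 1 \<and> j = 1 \<or> i = 3 \<and> j = 3 then - 1
      else 0)" for i j
  have ix: "i = 0 \<or> i = 1 \<or> i = 2 \<or> i = 3" for i :: 4
    using UNIV_4' by blast
  have AB: "(\<Sum>k\<in>UNIV. A i k * B k j) = (if i = j then 1 else 0)" for i j
    unfolding UNIV_4' using ix[of i] ix[of j] E
    by (elim disjE) (simp_all add: A_def B_def)
  have A: "godel_metric a p = (\<chi> i j. a\<^sup>2 * A i j)"
    unfolding godel_metric_def A_def E2 E_def[symmetric] ..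
  have "godel_metric a p ** (\<chi> i j. B i j / a\<^sup>2) = (\<chi> i j. \<Sum>k\<in>UNIV. A i k * B k j)"
    using assms by (simp add: A matrix_matrix_mult_def)
  then have "godel_metric a p ** (\<chi> i j. B i j / a\<^sup>2) = mat 1"
    by (simp add: AB mat_def)
  then show ?thesis
    by (metis invertible_right_inverse)
qed

end

theory Submission
  imports Defs
begin

text \<open>
  Write \<open>u, v, w, z\<close> for the components of the velocity and \<open>E = exp x\<^sub>1\<close>. As \<open>x\<^sub>0\<close> is cyclic, the
  momentum \<open>A = u + E w\<close> is constant, and the \<open>x\<^sub>1\<close>-equation becomes \<open>v' = (u\<^sup>2 - A\<^sup>2) / 2\<close>. Together
  they give
    \<open>(A x\<^sub>0 - v)' = A u - v' = v\<^sup>2 + z\<^sup>2 + ds\<^sup>2(\<gamma>', \<gamma>') / a\<^sup>2\<close>,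
  which is nonnegative along a causal geodesic. On a closed geodesic \<open>A x\<^sub>0 - v\<close> is periodic, hence
  constant, so \<open>v\<close>, \<open>z\<close> and \<open>ds\<^sup>2(\<gamma>', \<gamma>')\<close> all vanish. This excludes the timelike case; in the
  isotropic case \<open>A u = v' = 0\<close> and \<open>u\<^sup>2 = A\<^sup>2\<close> force \<open>\<gamma>' = 0\<close>.
\<close>

lemma matrix_mul_matrix_inv:
  assumes "invertible A"
  shows "A ** matrix_inv A = mat 1"
  using someI_ex[OF assms[unfolded invertible_def]] unfolding matrix_inv_def by blast

text \<open>Applying \<open>g\<close> to the geodesic equation cancels the \<open>matrix_inv\<close>
  hidden in \<open>christoffel\<close>. What remains involves only the metric coefficients and their
  partial derivatives.\<close>

lemma geodesic_lowered_equation: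
  assumes "geodesic g \<gamma>" and inv: "invertible (g (\<gamma> t))"
  shows "(\<Sum>k\<in>UNIV. g (\<gamma> t) $ l $ k * velocity (velocity \<gamma>) t $ k) =
    - (1 / 2) * (\<Sum>i\<in>UNIV. \<Sum>j\<in>UNIV.
        (partial i (\<lambda>q. g q $ j $ l) (\<gamma> t) + partial j (\<lambda>q. g q $ i $ l) (\<gamma> t)
          - partial l (\<lambda>q. g q $ i $ j) (\<gamma> t)) * velocity \<gamma> t $ i * velocity \<gamma> t $ j)"
proof -
  define y where "y = velocity \<gamma> t"
  \<comment> \<open>\<open>S l i j\<close> is twice the Christoffel symbol of the first
    kind.\<close>
  define S where "S l i j = partial i (\<lambda>q. g q $ j $ l) (\<gamma> t) + partial j (\<lambda>q. g q $ i $ l) (\<gamma> t)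
    - partial l (\<lambda>q. g q $ i $ j) (\<gamma> t)" for l i j
  define s where "s = (\<chi> l. - (1 / 2) * (\<Sum>i\<in>UNIV. \<Sum>j\<in>UNIV. S l i j * y $ i * y $ j))"
  let ?M = "matrix_inv (g (\<gamma> t))"
  have "velocity (velocity \<gamma>) t $ k = (?M *v s) $ k" for k
  proof -
    have "- (christoffel g k i j (\<gamma> t) * y $ i * y $ j) =
        (\<Sum>l\<in>UNIV. ?M $ k $ l * (- (1 / 2) * (S l i j * y $ i * y $ j)))" for i j
    proof -
      have "- (christoffel g k i j (\<gamma> t) * y $ i * y $ j) =
          (\<Sum>l\<in>UNIV. ?M $ k $ l * S l i j) * (- (1 / 2) * y $ i * y $ j)"
        unfolding christoffel_def S_def[symmetric] by algebra
      then show ?thesis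
        unfolding sum_distrib_right by (simp only: mult_ac)
    qed
    moreover have "velocity (velocity \<gamma>) t $ k =
        - (\<Sum>i\<in>UNIV. \<Sum>j\<in>UNIV. christoffel g k i j (\<gamma> t) * y $ i * y $ j)"
      using assms(1) unfolding geodesic_def y_def eq_neg_iff_add_eq_0 by blast
    ultimately have "velocity (velocity \<gamma>) t $ k =
        (\<Sum>i\<in>UNIV. \<Sum>j\<in>UNIV. \<Sum>l\<in>UNIV. ?M $ k $ l * (- (1 / 2) * (S l i j * y $ i * y $ j)))"
      by (simp flip: sum_negf)
    also have "\<dots> = (\<Sum>i\<in>UNIV. \<Sum>l\<in>UNIV. \<Sum>j\<in>UNIV. ?M $ k $ l * (- (1 / 2) * (S l i j * y $ i * y $ j)))"
      by (rule sum.cong[OF refl sum.swap])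
    also have "\<dots> = (\<Sum>l\<in>UNIV. \<Sum>i\<in>UNIV. \<Sum>j\<in>UNIV. ?M $ k $ l * (- (1 / 2) * (S l i j * y $ i * y $ j)))"
      by (rule sum.swap)
    also have "\<dots> = (?M *v s) $ k"
      by (simp add: s_def matrix_vector_mult_def sum_distrib_left sum_negf)
    finally show ?thesis .
  qed
  then have "velocity (velocity \<gamma>) t = ?M *v s"
    by (simp add: vec_eq_iff)
  then have "g (\<gamma> t) *v velocity (velocity \<gamma>) t = s"
    using matrix_mul_matrix_inv[OF inv] by (simp add: matrix_vector_mul_assoc)
  then have "(g (\<gamma> t) *v velocity (velocity \<gamma>) t) $ l = s $ l"
    by simp
  then show ?thesis
    by (simp add: matrix_vector_mult_def s_def S_def y_def)
qed

lemma has_real_derivative_velocity_nth: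
  assumes "\<gamma> differentiable at t"
  shows "((\<lambda>s. \<gamma> s $ k) has_real_derivative velocity \<gamma> t $ k) (at t)"
proof -
  have "(\<gamma> has_vector_derivative velocity \<gamma> t) (at t)"
    using assms unfolding velocity_def by (simp add: vector_derivative_works)
  then show ?thesis
    unfolding has_real_derivative_iff_has_vector_derivative
    by (rule bounded_linear.has_vector_derivative[OF bounded_linear_vec_nth])
qed

text \<open>The coefficients depend on the point through \<open>p $ 1\<close> alone. The factor 2
  from differentiating \<open>exp (2 * p $ 1)\<close> cancels the 1/2 in front of it.\<close>

lemma partial_godel_metric:
  "partial k (\<lambda>q. godel_metric a q $ i $ j) p =
    (if k \<noteq> 1 then 0
     else if i = 0 \<and> j = 2 \<or> i = 2 \<and> j = 0 then a\<^sup>2 * exp (p $ 1)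
     else if i = 2 \<and> j = 2 then a\<^sup>2 * (exp (p $ 1))\<^sup>2
     else 0)"
proof -
  have ix: "i = 0 \<or> i = 1 \<or> i = 2 \<or> i = 3" for i :: 4
    using UNIV_4' by blast
  have "((\<lambda>t. godel_metric a (p + t *\<^sub>R axis k 1) $ i $ j) has_real_derivative
    (if k \<noteq> 1 then 0
     else if i = 0 \<and> j = 2 \<or> i = 2 \<and> j = 0 then a\<^sup>2 * exp (p $ 1)
     else if i = 2 \<and> j = 2 then a\<^sup>2 * (exp (p $ 1))\<^sup>2
     else 0)) (at 0)"
    using ix[of i] ix[of j]
    by (cases "k = 1"; elim disjE)
      (auto simp: godel_metric_def axis_def exp_double[symmetric] intro!: derivative_eq_intros)
  then show ?thesis
    unfolding partial_def by (rule DERIV_imp_deriv)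
qed

text \<open>These are the lowered equations with index 0 and 1, divided by \<open>a\<^sup>2\<close>
  and \<open>- a\<^sup>2\<close>. The first is the conservation law of the cyclic coordinate,
  written out.\<close>

lemma godel_geodesic_equations:
  fixes \<gamma> :: "real \<Rightarrow> real ^ 4"
  assumes "a > 0" and "geodesic (godel_metric a) \<gamma>"
  defines "x \<equiv> velocity \<gamma>" and "y \<equiv> velocity (velocity \<gamma>)"
  shows "y t $ 0 + exp (\<gamma> t $ 1) * y t $ 2 + exp (\<gamma> t $ 1) * x t $ 1 * x t $ 2 = 0"
    and "y t $ 1 = - exp (\<gamma> t $ 1) * x t $ 0 * x t $ 2 - (exp (\<gamma> t $ 1))\<^sup>2 / 2 * (x t $ 2)\<^sup>2"
proof -
  note lowered = geodesic_lowered_equation[OF assms(2) invertible_godel_metric[OF assms(1)],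
      unfolded partial_godel_metric UNIV_4', folded x_def y_def]
  have "a\<^sup>2 * (y t $ 0 + exp (\<gamma> t $ 1) * y t $ 2 + exp (\<gamma> t $ 1) * x t $ 1 * x t $ 2) = 0"
    using lowered[of t 0] by (simp add: godel_metric_def algebra_simps)
  then show "y t $ 0 + exp (\<gamma> t $ 1) * y t $ 2 + exp (\<gamma> t $ 1) * x t $ 1 * x t $ 2 = 0"
    using assms(1) by simp
  have "a\<^sup>2 * y t $ 1 =
      a\<^sup>2 * (- exp (\<gamma> t $ 1) * x t $ 0 * x t $ 2 - (exp (\<gamma> t $ 1))\<^sup>2 / 2 * (x t $ 2)\<^sup>2)"
    using lowered[of t 1] by (simp add: godel_metric_def algebra_simps power2_eq_square)
  then show "y t $ 1 = - exp (\<gamma> t $ 1) * x t $ 0 * x t $ 2 - (exp (\<gamma> t $ 1))\<^sup>2 / 2 * (x t $ 2)\<^sup>2"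
    using assms(1) by simp
qed

lemma periodic_nonneg_deriv_eq_0:
  fixes f :: "real \<Rightarrow> real"
  assumes deriv: "\<And>t. (f has_real_derivative f' t) (at t)" and nonneg: "\<And>t. f' t \<ge> 0"
    and "T > 0" and periodic: "\<And>t. f (t + T) = f t"
  shows "f' t = 0"
proof -
  have mono: "f r \<le> f s" if "r \<le> s" for r s
    using that deriv nonneg by (meson DERIV_nonneg_imp_nondecreasing)
  \<comment> \<open>Squeeze over one period: for \<open>t \<le> s\<close>, monotonicity gives
    \<open>f t \<le> f s \<le> f (t + T) = f t\<close>; the other case uses
    \<open>t - T\<close>.\<close>
  have "f t = f s" if "\<bar>t - s\<bar> < T" for s
    using mono[of t s] mono[of s "t + T"] mono[of "t - T" s] mono[of s t] periodic[of t]
      periodic[of "t - T"] that by (cases "s \<le> t") auto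
  then show ?thesis
    using DERIV_local_const[OF deriv \<open>T > 0\<close>] by blast
qed

text \<open>Differentiate \<open>\<gamma> \<circ> (\<lambda>s. s + T) = \<gamma>\<close>; the shift
  has derivative 1.\<close>

lemma velocity_periodic:
  assumes "\<And>t. \<gamma> (t + T) = \<gamma> t" and "\<And>t. \<gamma> differentiable at t"
  shows "velocity \<gamma> (t + T) = velocity \<gamma> t"
proof -
  have "(\<gamma> has_vector_derivative velocity \<gamma> (t + T)) (at (t + T))"
    using assms(2) unfolding velocity_def by (simp add: vector_derivative_works[symmetric])
  then have "((\<gamma> \<circ> (\<lambda>s. s + T)) has_vector_derivative 1 *\<^sub>R velocity \<gamma> (t + T)) (at t)"
    by (intro vector_diff_chain_at) (auto intro!: derivative_eq_intros)
  moreover have "\<gamma> \<circ> (\<lambda>s. s + T) = \<gamma>"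
    using assms(1) by auto
  ultimately show ?thesis
    unfolding velocity_def[of \<gamma> t] by (simp add: vector_derivative_at)
qed

text \<open>Handles both causal types at once: a vanishing velocity contradicts
  \<open>isotropic\<close> as well as \<open>timelike\<close>.\<close>

lemma godel_closed_causal_geodesic:
  fixes \<gamma> :: "real \<Rightarrow> real ^ 4"
  assumes "a > 0" and geo: "geodesic (godel_metric a) \<gamma>" and "closed_curve \<gamma>"
    and causal: "\<And>t. metric_form (godel_metric a) (\<gamma> t) (velocity \<gamma> t) (velocity \<gamma> t) \<ge> 0"
  shows "velocity \<gamma> t = 0"
proof -
  define x where "x = velocity \<gamma>"
  define y where "y = velocity (velocity \<gamma>)"
  define E where "E t = exp (\<gamma> t $ 1)" for t
  define A where "A t = x t $ 0 + E t * x t $ 2" for t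
  \<comment> \<open>The line element evaluated on the velocity, divided by
    \<open>a\<^sup>2\<close>.\<close>
  define L where "L t = (x t $ 0)\<^sup>2 + 2 * E t * x t $ 0 * x t $ 2 + (E t)\<^sup>2 / 2 * (x t $ 2)\<^sup>2
      - (x t $ 1)\<^sup>2 - (x t $ 3)\<^sup>2" for t
  note eqs = godel_geodesic_equations[OF assms(1) geo, folded x_def y_def E_def]
  have diff: "\<gamma> differentiable at t" "velocity \<gamma> differentiable at t" for t
    using geo by (auto simp: geodesic_def)
  have dx[derivative_intros]: "((\<lambda>s. \<gamma> s $ k) has_real_derivative x t $ k) (at t)" for t k
    unfolding x_def by (rule has_real_derivative_velocity_nth[OF diff(1)])
  have dy[derivative_intros]: "((\<lambda>s. x s $ k) has_real_derivative y t $ k) (at t)" for t k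
    unfolding x_def y_def by (rule has_real_derivative_velocity_nth[OF diff(2)])
  \<comment> \<open>The derivative of \<open>E t\<close> is \<open>E t * x t $ 1\<close>, so this is
    the first geodesic equation.\<close>
  have "(A has_real_derivative 0) (at t)" for t
    unfolding A_def E_def
    by (rule derivative_eq_intros refl)+ (use eqs(1)[of t] in \<open>simp add: E_def algebra_simps\<close>)
  then have "A 0 = A t" for t
    using DERIV_isconst_all by blast
  then have A0: "A 0 = x t $ 0 + E t * x t $ 2" for t
    by (simp add: A_def)
  have L: "L t \<ge> 0" for t
  proof -
    have "a\<^sup>2 * L t \<ge> 0"
      using causal[of t] unfolding godel_line_element L_def E_def x_def exp_double by simp
    then show ?thesis
      using assms(1) by (simp add: zero_le_mult_iff)
  qed
  \<comment> \<open>Complete the square, with \<open>E t * x t $ 2 = A 0 - x t $ 0\<close>.\<close>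
  have y1: "y t $ 1 = ((x t $ 0)\<^sup>2 - (A 0)\<^sup>2) / 2" for t
    unfolding A0[of t] eqs(2) by (simp add: field_simps power2_eq_square)
  define f where "f t = A 0 * \<gamma> t $ 0 - x t $ 1" for t
  define f' where "f' t = A 0 * x t $ 0 - y t $ 1" for t
  have f: "(f has_real_derivative f' t) (at t)" for t
    unfolding f_def f'_def by (auto intro!: derivative_eq_intros)
  have f': "f' t = (x t $ 1)\<^sup>2 + (x t $ 3)\<^sup>2 + L t" for t
    unfolding f'_def eqs(2) L_def A0[of t] by (simp add: field_simps power2_eq_square)
  obtain T where "T > 0" and T: "\<And>t. \<gamma> (t + T) = \<gamma> t"
    using assms(3) by (auto simp: closed_curve_def)
  have "f (t + T) = f t" for t
    using velocity_periodic[OF T diff(1)] by (simp add: f_def T x_def)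
  then have f'0: "f' t = 0" for t
    using periodic_nonneg_deriv_eq_0[OF f _ \<open>T > 0\<close>] f' L by simp
  \<comment> \<open>Three nonnegative terms add up to \<open>f' t = 0\<close>.\<close>
  have sq: "(x t $ 1)\<^sup>2 = 0 \<and> (x t $ 3)\<^sup>2 = 0" for t
    using f'[of t] f'0[of t] L[of t] zero_le_power2[of "x t $ 1"] zero_le_power2[of "x t $ 3"]
    by linarith
  then have x13: "x t $ 1 = 0" "x t $ 3 = 0" for t
    by simp_all
  have "y t $ 1 = 0"
    using dy[of 1 t] DERIV_const[of 0] by (simp add: x13 DERIV_unique)
  then have "A 0 * x t $ 0 = 0" "(x t $ 0)\<^sup>2 = (A 0)\<^sup>2"
    using f'0[of t] y1[of t] by (simp_all add: f'_def)
  \<comment> \<open>The product makes one factor zero; equality of the squares makes the other zero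
    too.\<close>
  then have "A 0 = 0" "x t $ 0 = 0"
    by auto
  moreover from this have "x t $ 2 = 0"
    using A0[of t] by (simp add: E_def)
  ultimately have "\<forall>k\<in>{0, 1, 2, 3}. x t $ k = 0"
    using x13 by simp
  then have "x t = 0"
    by (simp add: vec_eq_iff flip: UNIV_4')
  then show ?thesis
    by (simp add: x_def)
qed

theorem theorem3:
  fixes a :: real
  assumes "a > 0"
  shows "\<not> (\<exists>\<gamma>. geodesic (godel_metric a) \<gamma> \<and> closed_curve \<gamma> \<and> isotropic (godel_metric a) \<gamma>) \<and>
         \<not> (\<exists>\<gamma>. geodesic (godel_metric a) \<gamma> \<and> closed_curve \<gamma> \<and> timelike (godel_metric a) \<gamma>)"
proof (intro conjI notI; elim exE conjE)
  fix \<gamma> :: "real \<Rightarrow> real ^ 4"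
  assume \<gamma>: "geodesic (godel_metric a) \<gamma>" "closed_curve \<gamma>" and iso: "isotropic (godel_metric a) \<gamma>"
  have "velocity \<gamma> 0 = 0"
    by (rule godel_closed_causal_geodesic[OF assms \<gamma>]) (use iso in \<open>simp add: isotropic_def\<close>)
  then show False
    using iso by (simp add: isotropic_def)
next
  fix \<gamma> :: "real \<Rightarrow> real ^ 4"
  assume \<gamma>: "geodesic (godel_metric a) \<gamma>" "closed_curve \<gamma>" and tl: "timelike (godel_metric a) \<gamma>"
  have "velocity \<gamma> 0 = 0"
    by (rule godel_closed_causal_geodesic[OF assms \<gamma>]) (use tl in \<open>simp add: timelike_def less_imp_le\<close>)
  moreover have "metric_form (godel_metric a) (\<gamma> 0) (velocity \<gamma> 0) (velocity \<gamma> 0) > 0"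
    using tl by (simp add: timelike_def)
  \<comment> \<open>The metric form vanishes on the zero vector, so it cannot be positive
    there.\<close>
  ultimately show False
    by (simp add: metric_form_def)
qed

end
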